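(* Let $\varphi:\mathbb{N}\to\mathbb{N}\cup\{\infty\}$ satisfy $\varphi(1)\neq\infty$ and $\sum_{n=1}^{\infty}\frac{1}{\varphi(n)}=\infty$ (with $1/\infty=0$), and let $(a_n)_{n=1}^{\infty}$ be the increasing sequence of positive integers such that $\varphi(a)\neq\infty$ if and only if $a=a_n$ for some $n$. Let $$F_\varphi:=\{\alpha=[0;u_1,u_2,\ldots]\in[0,1)\;|\;u_n\leq\varphi(n)\text{ for every } n\}.$$ Then for every $n\in\mathbb{N}$ there exists a set $F_\varphi^{(a_n)}\subseteq[0,1)$ with $F_\varphi\subseteq F_\varphi^{(a_n)}$ and $$\mu\big(F_\varphi^{(a_n)}\big)<\prod_{j=1}^{n}\left(1-\frac{1}{3(\varphi(a_j)+2)}\right).$$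
   Context: $\mu$ denotes Lebesgue measure; $[0;u_1,u_2,\ldots]$ denotes the continued fraction expansion with $u_j\in\mathbb{N}$. *)

theory Defs
  imports "HOL-Analysis.Analysis"
begin

text \<open>
  Sequences are indexed from 1; values at index 0 are ignored throughout.
  \<open>cf_convergent n u\<close> is the finite continued fraction \<open>[0; u 1, \<dots>, u n]\<close>.
\<close>

primrec cf_convergent :: "nat \<Rightarrow> (nat \<Rightarrow> nat) \<Rightarrow> real" where
  "cf_convergent 0 u = 0"
| "cf_convergent (Suc n) u = 1 / (real (u 1) + cf_convergent n (\<lambda>j. u (Suc j)))"

text \<open>\<open>has_cf_expansion \<alpha> u\<close> is \<open>\<alpha> = [0; u 1, u 2, \<dots>]\<close> (an infinite expansion).\<close>

definition has_cf_expansion :: "real \<Rightarrow> (nat \<Rightarrow> nat) \<Rightarrow> bool" where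
  "has_cf_expansion \<alpha> u \<longleftrightarrow>
     (\<forall>j\<ge>1. u j \<ge> 1) \<and> (\<lambda>n. cf_convergent n u) \<longlonglongrightarrow> \<alpha>"

definition cf_bounded_set :: "(nat \<Rightarrow> enat) \<Rightarrow> real set" where
  "cf_bounded_set \<phi> =
     {\<alpha> \<in> {0..<1}. \<exists>u. has_cf_expansion \<alpha> u \<and> (\<forall>n\<ge>1. enat (u n) \<le> \<phi> n)}"

end

theory Submission imports Defs "HOL-Real_Asymp.Real_Asymp" begin

text \<open>
  A cylinder of continued fractions with prescribed first digits is the image of \<open>[0,1]\<close> under
  \<open>t \<mapsto> (p + p' t) / (q + q' t)\<close> with determinant \<open>\<plusminus>1\<close>, so it has length \<open>1 / (q (q + q'))\<close>.
  The subcylinder with next digit \<open>u\<close> belongs to \<open>(p u + p', p, q u + q', q)\<close>, and the lengths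
  of the subcylinders telescope: restricting the next digit to \<open>u \<le> m\<close> retains a proportion of at
  most \<open>m / (m + 1)\<close> of the measure, which is smaller than \<open>1 - 1 / (3 (m + 2))\<close>.
\<close>

text \<open>Each further digit reverses orientation, so \<open>closed_segment\<close> is used rather
  than an ordered interval. Writing the digit as \<open>Suc i\<close> makes it positive, and
  shifting \<phi> keeps the next digit at position 1.\<close>

primrec bounded_cylinders ::
    "nat \<Rightarrow> real \<Rightarrow> real \<Rightarrow> real \<Rightarrow> real \<Rightarrow> (nat \<Rightarrow> enat) \<Rightarrow> real set" where
  "bounded_cylinders 0 p p' q q' \<phi> = closed_segment (p / q) ((p + p') / (q + q'))"
| "bounded_cylinders (Suc N) p p' q q' \<phi> =
     (\<Union>i. if enat (Suc i) \<le> \<phi> 1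
          then bounded_cylinders N (p * real (Suc i) + p') p (q * real (Suc i) + q') q
                 (\<lambda>j. \<phi> (Suc j))
          else {})"

text \<open>An unrestricted digit gets the factor 1, so products over all positions reduce to those
  with a finite bound.\<close>

definition retained :: "enat \<Rightarrow> real" where
  "retained x = (case x of enat m \<Rightarrow> real m / (real m + 1) | \<infinity> \<Rightarrow> 1)"

section \<open>Measure of the cylinder unions\<close>

lemma retained_nonneg: "0 \<le> retained x"
  by (cases x) (auto simp: retained_def)

lemma bounded_cylinders_borel: "bounded_cylinders N p p' q q' \<phi> \<in> sets borel"
  by (induction N arbitrary: p p' q q' \<phi>) (auto intro!: sets.countable_UN)

text \<open>For a bound m, the discarded proportion is \<open>(q + q') / (q * (m + 1) + q')\<close>.
  Since \<open>q' \<ge> 0\<close>, it is at least \<open>1 / (m + 1)\<close>, with equality at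
  \<open>q' = 0\<close>.\<close>

lemma subcylinder_length_sums:
  fixes q q' :: real
  assumes "q > 0" "q' \<ge> 0"
  shows "\<exists>L. (\<lambda>i. if enat (Suc i) \<le> x
               then 1 / ((q * real (Suc i) + q') * (q * real (Suc i) + q' + q)) else 0) sums L
             \<and> L \<le> retained x * (1 / (q * (q + q')))"
proof -
  \<comment> \<open>\<open>g i\<close> is the length of the part of the cylinder where the next
    digit is at least \<open>Suc i\<close>, that is, of the image of
    \<open>[0, 1 / Suc i]\<close>.\<close>
  define g where "g i = 1 / (q * (q * real (Suc i) + q'))" for i
  have pos: "q * real (Suc i) + q' > 0" for i
    using assms by (simp add: add_pos_nonneg)
  have tele: "1 / ((q * real (Suc i) + q') * (q * real (Suc i) + q' + q)) = g i - g (Suc i)" for i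
  proof -
    define d where "d = q * real (Suc i) + q'"
    have "d > 0" "q * real (Suc (Suc i)) + q' = d + q"
      using pos[of i] by (simp_all add: d_def algebra_simps)
    then have "1 / (d * (d + q)) = 1 / (q * d) - 1 / (q * (d + q))"
      using assms by (simp add: divide_simps)
    then show ?thesis
      using \<open>q * real (Suc (Suc i)) + q' = d + q\<close> unfolding g_def d_def by simp
  qed
  have g0: "g 0 = 1 / (q * (q + q'))"
    by (simp add: g_def)
  show ?thesis
  proof (cases x)
    case (enat m)
    have "(\<lambda>i. if i \<in> {..<m} then g i - g (Suc i) else 0) sums (\<Sum>i<m. g i - g (Suc i))"
      by (rule sums_If_finite_set) simp
    moreover have "(\<Sum>i<m. g i - g (Suc i)) = g 0 - g m"
      by (rule sum_lessThan_telescope')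
    ultimately have s: "(\<lambda>i. if enat (Suc i) \<le> x then g i - g (Suc i) else 0) sums (g 0 - g m)"
      by (simp add: enat Suc_le_eq)
    have "g m \<ge> 1 / (real m + 1) * g 0"
    proof -
      have "q * real (Suc m) + q' \<le> (real m + 1) * (q + q')"
        using assms by (simp add: algebra_simps)
      then have "1 / (q * ((real m + 1) * (q + q'))) \<le> 1 / (q * (q * real (Suc m) + q'))"
        using assms pos[of m] by (intro divide_left_mono mult_left_mono mult_pos_pos) auto
      then show ?thesis
        by (simp add: g_def mult.assoc mult.left_commute)
    qed
    then have "g 0 - g m \<le> retained x * g 0"
      by (simp add: enat retained_def field_simps)
    then show ?thesis
      using s unfolding tele g0 by blast
  next
    case infinity
    have "g \<longlonglongrightarrow> 0"
      unfolding g_def using assms by real_asymp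
    then have "(\<lambda>i. g i - g (Suc i)) sums (g 0 - 0)"
      by (rule telescope_sums')
    then show ?thesis
      unfolding tele g0[symmetric] by (intro exI[of _ "g 0"]) (simp add: infinity retained_def)
  qed
qed

text \<open>Induction peels off the first digit, so the coefficients must be arbitrary. Only an
  upper bound is wanted: countable subadditivity suffices, although neighbouring closed cylinders
  share endpoints.\<close>

lemma emeasure_bounded_cylinders_le:
  assumes "q > 0" "q' \<ge> 0" "\<bar>p * q' - p' * q\<bar> = 1"
  shows "emeasure lborel (bounded_cylinders N p p' q q' \<phi>)
         \<le> ennreal ((\<Prod>k<N. retained (\<phi> (Suc k))) * (1 / (q * (q + q'))))"
  using assms
proof (induction N arbitrary: p p' q q' \<phi>)
  case 0
  have "(p + p') / (q + q') - p / q = - (p * q' - p' * q) / (q * (q + q'))"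
    using "0.prems" by (simp add: field_simps)
  then have "\<bar>(p + p') / (q + q') - p / q\<bar> = 1 / (q * (q + q'))"
    using "0.prems" by (simp add: abs_divide abs_mult)
  then have "emeasure lborel (closed_segment (p / q) ((p + p') / (q + q')))
             = ennreal (1 / (q * (q + q')))"
    by (auto simp: closed_segment_eq_real_ivl abs_if split: if_splits)
  then show ?case by simp
next
  case (Suc N)
  let ?P = "\<Prod>k<N. retained (\<phi> (Suc (Suc k)))"
  let ?l = "\<lambda>i. 1 / ((q * real (Suc i) + q') * (q * real (Suc i) + q' + q))"
  let ?D = "\<lambda>i. if enat (Suc i) \<le> \<phi> 1
       then bounded_cylinders N (p * real (Suc i) + p') p (q * real (Suc i) + q') q (\<lambda>j. \<phi> (Suc j))
       else {}"
  let ?f = "\<lambda>i. if enat (Suc i) \<le> \<phi> 1 then ?l i else 0"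
  have P: "?P \<ge> 0"
    by (intro prod_nonneg) (simp add: retained_nonneg)
  have pos: "q * real (Suc i) + q' > 0" for i
    using Suc.prems by (simp add: add_pos_nonneg)
  have f: "?f i \<ge> 0" for i
    using pos[of i] Suc.prems by simp
  obtain L where L: "?f sums L" "L \<le> retained (\<phi> 1) * (1 / (q * (q + q')))"
    using subcylinder_length_sums[OF Suc.prems(1,2)] by blast
  have D: "emeasure lborel (?D i) \<le> ennreal (?P * ?f i)" for i
  proof -
    \<comment> \<open>Appending a digit flips the sign of the determinant, which is why the
      invariant is about its absolute value.\<close>
    have "(p * real (Suc i) + p') * q - p * (q * real (Suc i) + q') = - (p * q' - p' * q)"
      by (simp add: algebra_simps)
    then have "\<bar>(p * real (Suc i) + p') * q - p * (q * real (Suc i) + q')\<bar> = 1"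
      using Suc.prems by simp
    then show ?thesis
      using Suc.IH[OF pos[of i], of q "p * real (Suc i) + p'" p "\<lambda>j. \<phi> (Suc j)"] Suc.prems
      by auto
  qed
  have "emeasure lborel (\<Union>i. ?D i) \<le> (\<Sum>i. emeasure lborel (?D i))"
    by (intro emeasure_subadditive_countably) (auto simp: bounded_cylinders_borel)
  also have "\<dots> \<le> (\<Sum>i. ennreal (?P * ?f i))"
    by (intro suminf_le D) auto
  also have "\<dots> = ennreal (?P * L)"
    using sums_mult[OF L(1), of ?P] P f by (intro suminf_ennreal_eq) auto
  also have "\<dots> \<le> ennreal (?P * (retained (\<phi> 1) * (1 / (q * (q + q')))))"
    using P L(2) by (intro ennreal_leI mult_left_mono) auto
  also have "?P * (retained (\<phi> 1) * (1 / (q * (q + q'))))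
             = (\<Prod>k<Suc N. retained (\<phi> (Suc k))) * (1 / (q * (q + q')))"
    by (subst prod.lessThan_Suc_shift) simp
  finally show ?case by simp
qed

section \<open>Tails of expansions and membership in cylinders\<close>

lemma cf_convergent_bounds:
  assumes "\<forall>j\<ge>1. u j \<ge> 1"
  shows "0 \<le> cf_convergent n u \<and> cf_convergent n u \<le> 1"
  using assms
proof (induction n arbitrary: u)
  case (Suc n)
  have "0 \<le> cf_convergent n (\<lambda>j. u (Suc j))"
    using Suc by simp
  moreover have "real (u 1) \<ge> 1"
    using Suc.prems by (metis le_refl of_nat_1 of_nat_mono)
  ultimately show ?case by simp
qed simp

lemma has_cf_expansion_bounds:
  assumes "has_cf_expansion \<alpha> u"
  shows "0 \<le> \<alpha>" "\<alpha> \<le> 1"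
  using assms cf_convergent_bounds[of u] unfolding has_cf_expansion_def
  by (auto intro: LIMSEQ_le_const LIMSEQ_le_const2)

text \<open>Convergence of the tail is not part of the hypothesis; it follows by inverting the
  recursion for the convergents, once \<alpha> is known to be nonzero.\<close>

lemma has_cf_expansion_shift:
  assumes "has_cf_expansion \<alpha> u"
  obtains \<beta> where "has_cf_expansion \<beta> (\<lambda>j. u (Suc j))" "\<alpha> = 1 / (real (u 1) + \<beta>)"
proof -
  let ?c = "\<lambda>n. cf_convergent n (\<lambda>j. u (Suc j))"
  have u: "\<forall>j\<ge>1. u j \<ge> 1" and lim: "(\<lambda>n. cf_convergent n u) \<longlonglongrightarrow> \<alpha>"
    using assms by (auto simp: has_cf_expansion_def)
  have u1: "real (u 1) \<ge> 1"
    using u by (metis le_refl of_nat_1 of_nat_mono)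
  have c: "0 \<le> ?c n" "?c n \<le> 1" for n
    using cf_convergent_bounds[of "\<lambda>j. u (Suc j)" n] u by auto
  have lim': "(\<lambda>n. 1 / (real (u 1) + ?c n)) \<longlonglongrightarrow> \<alpha>"
    using LIMSEQ_Suc[OF lim] by simp
  \<comment> \<open>A positive lower bound uniform in n keeps the limit away from 0, so that
    reciprocals may be taken in the limit.\<close>
  have "1 / (real (u 1) + 1) \<le> 1 / (real (u 1) + ?c n)" for n
    using c[of n] u1 by (intro divide_left_mono mult_pos_pos) auto
  then have "1 / (real (u 1) + 1) \<le> \<alpha>"
    by (intro LIMSEQ_le_const[OF lim']) auto
  moreover have "0 < 1 / (real (u 1) + 1)"
    using u1 by simp
  ultimately have \<alpha>: "\<alpha> > 0"
    by linarith
  have "(\<lambda>n. 1 / (1 / (real (u 1) + ?c n)) - real (u 1)) \<longlonglongrightarrow> 1 / \<alpha> - real (u 1)"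
    using \<alpha> by (intro tendsto_intros lim') auto
  then have "has_cf_expansion (1 / \<alpha> - real (u 1)) (\<lambda>j. u (Suc j))"
    using u by (simp add: has_cf_expansion_def)
  then show ?thesis
    using that \<alpha> by simp
qed

text \<open>Substituting \<open>\<alpha> = 1 / (u 1 + \<beta>)\<close> turns the fraction into the
  same expression in the tail \<beta> with the coefficients of the subcylinder. At depth 0 only
  \<open>0 \<le> \<alpha>\<close> and \<open>\<alpha> \<le> 1\<close> matter, as the segments are
  closed.\<close>

lemma moebius_in_bounded_cylinders:
  assumes "q > 0" "q' \<ge> 0" "has_cf_expansion \<alpha> u" "\<forall>n\<ge>1. enat (u n) \<le> \<phi> n"
  shows "(p + p' * \<alpha>) / (q + q' * \<alpha>) \<in> bounded_cylinders N p p' q q' \<phi>"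
  using assms
proof (induction N arbitrary: p p' q q' \<phi> u \<alpha>)
  case 0
  note \<alpha> = has_cf_expansion_bounds[OF "0.prems"(3)]
  have d: "q + q' * \<alpha> > 0" "q + q' > 0"
    using "0.prems" \<alpha> by (simp_all add: add_pos_nonneg)
  \<comment> \<open>The point is a mean of the two endpoints with weights
    \<open>q * (1 - \<alpha>)\<close> and \<open>(q + q') * \<alpha>\<close>, whose sum is
    \<open>q + q' * \<alpha>\<close>; l is the normalised second weight.\<close>
  define l where "l = \<alpha> * (q + q') / (q + q' * \<alpha>)"
  have l1: "1 - l = q * (1 - \<alpha>) / (q + q' * \<alpha>)"
    using d by (simp add: l_def field_simps)
  have "0 \<le> l" "0 \<le> 1 - l"
    using d \<alpha> "0.prems" unfolding l1 by (simp_all add: l_def)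
  moreover have "(1 - l) * (p / q) = p * (1 - \<alpha>) / (q + q' * \<alpha>)"
    unfolding l1 using "0.prems" by simp
  moreover have "l * ((p + p') / (q + q')) = \<alpha> * (p + p') / (q + q' * \<alpha>)"
    unfolding l_def using d by simp
  moreover have "p * (1 - \<alpha>) / (q + q' * \<alpha>) + \<alpha> * (p + p') / (q + q' * \<alpha>)
      = (p + p' * \<alpha>) / (q + q' * \<alpha>)"
    by (simp add: add_divide_distrib[symmetric] algebra_simps)
  ultimately show ?case
    by (auto simp: closed_segment_def intro!: exI[of _ l])
next
  case (Suc N)
  obtain \<beta> where \<beta>: "has_cf_expansion \<beta> (\<lambda>j. u (Suc j))" "\<alpha> = 1 / (real (u 1) + \<beta>)"
    using has_cf_expansion_shift[OF Suc.prems(3)] .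
  have "u 1 \<ge> 1"
    using Suc.prems(3) by (simp add: has_cf_expansion_def)
  then obtain i where i: "u 1 = Suc i"
    by (cases "u 1") auto
  have \<beta>0: "\<beta> \<ge> 0"
    using has_cf_expansion_bounds[OF \<beta>(1)] by simp
  \<comment> \<open>Numerator and denominator in \<alpha> both get multiplied by
    \<open>d = 1 / \<alpha>\<close> on passing to \<beta>, so the quotient is unchanged.\<close>
  define d where "d = real (Suc i) + \<beta>"
  have d: "d > 0" "\<alpha> = 1 / d"
    using \<beta>0 \<beta>(2) i by (simp_all add: d_def)
  have "q * real (Suc i) + q' > 0"
    using Suc.prems by (simp add: add_pos_nonneg)
  then have "(p * real (Suc i) + p' + p * \<beta>) / (q * real (Suc i) + q' + q * \<beta>)
      \<in> bounded_cylinders N (p * real (Suc i) + p') p (q * real (Suc i) + q') q (\<lambda>j. \<phi> (Suc j))"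
    using Suc.prems \<beta>(1) by (intro Suc.IH) auto
  moreover have "(p * real (Suc i) + p' + p * \<beta>) / (q * real (Suc i) + q' + q * \<beta>)
      = (p + p' * \<alpha>) / (q + q' * \<alpha>)"
  proof -
    have "p * real (Suc i) + p' + p * \<beta> = d * (p + p' * \<alpha>)"
      "q * real (Suc i) + q' + q * \<beta> = d * (q + q' * \<alpha>)"
      using d(1) unfolding d(2) by (simp_all add: field_simps) (simp_all add: d_def algebra_simps)
    then show ?thesis
      using d by simp
  qed
  moreover have "enat (Suc i) \<le> \<phi> 1"
    using Suc.prems(4) i by (metis le_refl)
  ultimately show ?case
    by (auto intro!: exI[of _ i])
qed

section \<open>Reduction to the finite bounds and conclusion\<close>

lemma prod_retained_reindex:
  fixes a :: "nat \<Rightarrow> nat"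
  assumes mono: "strict_mono_on {1..} a" and a1: "\<forall>n\<ge>1. a n \<ge> 1"
    and fin: "\<forall>k\<ge>1. \<phi> k \<noteq> \<infinity> \<longleftrightarrow> (\<exists>n\<ge>1. k = a n)" and n: "n \<ge> 1"
  shows "(\<Prod>k<a n. retained (\<phi> (Suc k))) = (\<Prod>j=1..n. retained (\<phi> (a j)))"
proof -
  have inj: "inj_on a {1..n}"
    using strict_mono_on_imp_inj_on[OF mono] by (rule inj_on_subset) auto
  have sub: "a ` {1..n} \<subseteq> {1..a n}"
    using a1 strict_mono_on_leD[OF mono] by auto
  \<comment> \<open>A finite bound at such a position would be at some \<open>a j\<close> with
    \<open>j > n\<close>, which lies beyond \<open>a n\<close> by monotonicity.\<close>
  have one: "retained (\<phi> k) = 1" if k: "k \<in> {1..a n} - a ` {1..n}" for k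
  proof -
    have "\<phi> k = \<infinity>"
    proof (rule ccontr)
      assume "\<phi> k \<noteq> \<infinity>"
      then obtain j where j: "j \<ge> 1" "k = a j"
        using fin k by auto
      then have "\<not> j \<le> n"
        using k by auto
      then have "a n < a j"
        using n j by (intro strict_mono_onD[OF mono]) auto
      then show False
        using k j by simp
    qed
    then show ?thesis by (simp add: retained_def)
  qed
  have "(\<Prod>k<a n. retained (\<phi> (Suc k))) = (\<Prod>k=1..a n. retained (\<phi> k))"
    by (rule prod.reindex_bij_witness[of _ "\<lambda>k. k - 1" Suc]) auto
  also have "\<dots> = (\<Prod>k\<in>a ` {1..n}. retained (\<phi> k))"
    using sub one by (intro prod.mono_neutral_right) auto
  also have "\<dots> = (\<Prod>j=1..n. retained (\<phi> (a j)))"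
    using inj by (simp add: prod.reindex)
  finally show ?thesis .
qed

theorem theorem2p3:
  fixes \<phi> :: "nat \<Rightarrow> enat" and a :: "nat \<Rightarrow> nat"
  assumes "\<forall>n\<ge>1. \<phi> n \<ge> 1"
    and "\<phi> 1 \<noteq> \<infinity>"
    and "(\<Sum>n. 1 / ennreal_of_enat (\<phi> (Suc n))) = \<infinity>"
    and "strict_mono_on {1..} a"
    and "\<forall>n\<ge>1. a n \<ge> 1"
    and "\<forall>k\<ge>1. \<phi> k \<noteq> \<infinity> \<longleftrightarrow> (\<exists>n\<ge>1. k = a n)"
  shows "\<forall>n\<ge>1. \<exists>S. S \<subseteq> {0..<1} \<and> cf_bounded_set \<phi> \<subseteq> S \<and> S \<in> sets lebesgue \<and>
           measure lebesgue S < (\<Prod>j=1..n. 1 - 1 / (3 * (real (the_enat (\<phi> (a j))) + 2)))"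
proof (intro allI impI)
  fix n :: nat
  assume n: "n \<ge> 1"
  \<comment> \<open>These coefficients give the identity map, with initial length 1. Depth
    \<open>a n\<close> takes in exactly the first n finite bounds. The intersection below is needed
    because closed cylinders may contain 1.\<close>
  let ?B = "bounded_cylinders (a n) 0 1 1 0 \<phi>"
  let ?S = "?B \<inter> {0..<1}"
  let ?W = "\<Prod>j=1..n. retained (\<phi> (a j))"
  have cover: "cf_bounded_set \<phi> \<subseteq> ?S"
    using moebius_in_bounded_cylinders[of 1 0 _ _ \<phi> 0 1 "a n"] by (auto simp: cf_bounded_set_def)
  have borel: "?S \<in> sets borel"
    by (intro sets.Int bounded_cylinders_borel) simp
  have "emeasure lborel ?S \<le> emeasure lborel ?B"
    by (intro emeasure_mono) (auto simp: bounded_cylinders_borel)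
  also have "\<dots> \<le> ennreal ?W"
    using emeasure_bounded_cylinders_le[of 1 0 0 1 "a n" \<phi>]
      prod_retained_reindex[OF assms(4-6) n] by simp
  finally have "measure lborel ?S \<le> ?W"
    unfolding measure_def by (intro enn2real_leI prod_nonneg) (auto simp: retained_nonneg)
  then have meas: "measure lebesgue ?S \<le> ?W"
    using borel by (simp add: measure_completion)
  have "?W < (\<Prod>j=1..n. 1 - 1 / (3 * (real (the_enat (\<phi> (a j))) + 2)))"
  proof -
    have less: "retained (\<phi> (a j)) < 1 - 1 / (3 * (real (the_enat (\<phi> (a j))) + 2))"
      if "j \<in> {1..n}" for j
    proof -
      have "\<phi> (a j) \<noteq> \<infinity>"
        using assms(5,6) that by auto
      then obtain m where m: "\<phi> (a j) = enat m"
        by auto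
      have "real m / (real m + 1) = 1 - 1 / (real m + 1)"
        by (simp add: field_simps)
      \<comment> \<open>The constants 3 and 2 leave ample room: only
        \<open>m + 1 < 3 * (m + 2)\<close> is required.\<close>
      moreover have "1 / (3 * (real m + 2)) < 1 / (real m + 1)"
        by (intro divide_strict_left_mono) auto
      ultimately show ?thesis
        by (simp add: m retained_def)
    qed
    show ?thesis
      \<comment> \<open>Index 1 is in the range since \<open>n \<ge> 1\<close> and witnesses
        strictness; the right-hand factors are positive because they exceed nonnegative
        ones.\<close>
      using n less retained_nonneg
      by (intro prod_mono_strict[of 1]) (auto intro: less_imp_le le_less_trans)
  qed
  then show "\<exists>S. S \<subseteq> {0..<1} \<and> cf_bounded_set \<phi> \<subseteq> S \<and> S \<in> sets lebesgue \<and>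
      measure lebesgue S < (\<Prod>j=1..n. 1 - 1 / (3 * (real (the_enat (\<phi> (a j))) + 2)))"
    using meas cover borel by (intro exI[of _ ?S]) auto
qed

end
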